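(* Let $F$ be a clause set. If the reasoning algorithm with inference rules $\mathrm{A1}^+$, $\mathrm{A2}^+$, and A3, started from $\mathcal{S}_0=\{F\}$, yields a complete and clash-free family of clause sets $\mathcal{S}_n$, then $F$ is satisfiable.
   Context: $\mathcal{ALC}$ interpretations $\mathcal{I}=(\Delta^\mathcal{I},\cdot^\mathcal{I})$ with the standard semantics of $\lnot,\sqcap,\sqcup,\forall R.,\exists R.$. Conjunctive normal forms are defined by mutual induction: a concept literal is $A$, $\lnot A$ ($A$ a concept name), $\exists R.F$ or $\forall R.F$ ($R$ a role name, $F$ a conjunctive normal form); a clause is a finite disjunction of concept literals, represented as a set of literals; a conjunctive normal form is a finite conjunction of clauses, represented as a clause set. A clause set denotes the conjunction of its clauses, each clause the disjunction of its literals; $F$ is satisfiable if $F^\mathcal{I}\neq\emptyset$ for some $\mathcal{I}$. The complementary literal $\overline{L}$ is: $\overline{A}=\lnot A$, $\overline{\lnot A}=A$, $\overline{\exists R.F}=\forall R.\mathrm{CNF}(\lnot F)$, $\overline{\forall R.F}=\exists R.\mathrm{CNF}(\lnot F)$, with $\mathrm{CNF}(C)$ the equivalent conjunctive normal form of $C$ (push negations inward, distribute $\sqcup$ over $\sqcap$, flatten). A derivation works on families of clause sets $\mathcal{S}_i$, starting with $\mathcal{S}_0=\{F\}$; $\mathcal{S}_{i+1}$ is obtained from $\mathcal{S}_i$ by applying one of the following rules to a clause set $F\in\mathcal{S}_i$: ($\mathrm{A1}^+$) if $L\in CL$ for a clause $CL\in F$ (nondeterministic choice of $L$): replace every clause $CL'\in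 F$ with $L\in CL'$ by $\{L\}$, and every clause $CL'\in F$ with $\overline{L}\in CL'$ by $CL'\setminus\{\overline{L}\}$. ($\mathrm{A2}^+$) if all clauses of $F$ are unit clauses and $\forall R.F_1\in CL$ for some $CL\in F$: remove from $F$ all clauses containing $\forall R.F_1$, and replace every literal $\exists R.F_2$ occurring in clauses of $F$ by $\exists R.(F_1\cup F_2)$. (A3) if all clauses of $F$ are unit clauses of the form $\{A\}$, $\{\lnot A\}$ or $\{\exists R.F'\}$: for some $\{\exists R.F_1\}\in F$, replace $F$ by $F\setminus\{\{\exists R.F_1\}\}$ and add $F_1$ to the family ($F$ is the parent of $F_1$ with respect to $R$). A family is complete if no rule is applicable to it. It is clash-free if no clause set in it contains the empty clause or contains both $\{L\}$ and $\{\overline{L}\}$ for some literal $L$. *)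

theory Defs
  imports "HOL-Library.FSet" "HOL-Library.FuncSet"
begin

section \<open>Concept literals, clauses and conjunctive normal forms\<close>

datatype ('c, 'r) lit =
    Pos 'c
  | Neg 'c
  | Ex 'r "('c, 'r) lit fset fset"
  | All 'r "('c, 'r) lit fset fset"

type_synonym ('c, 'r) clause = "('c, 'r) lit fset"

text \<open>A conjunctive normal form is the same thing as a finite clause set.\<close>

type_synonym ('c, 'r) cset = "('c, 'r) clause fset"

lemma size_lit_less:
  fixes F :: "('c, 'r) cset"
  assumes "CL |\<in>| F" "L |\<in>| CL"
  shows "size L < size (Ex R F)" "size L < size (All R F)"
proof -
  have "Suc (size L) \<le> (\<Sum>L \<in> fset CL. Suc (size L))"
    using assms(2) by (intro member_le_sum) auto
  moreover have "Suc (\<Sum>L \<in> fset CL. Suc (size L))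
      \<le> (\<Sum>CL \<in> fset F. Suc (\<Sum>L \<in> fset CL. Suc (size L)))"
    using assms(1) by (intro member_le_sum[where f = "\<lambda>CL. Suc (\<Sum>L \<in> fset CL. Suc (size L))"]) auto
  ultimately show "size L < size (Ex R F)" "size L < size (All R F)"
    by auto
qed


section \<open>Semantics\<close>

record ('d, 'c, 'r) interp =
  Dom :: "'d set"
  con :: "'c \<Rightarrow> 'd set"
  rol :: "'r \<Rightarrow> ('d \<times> 'd) set"

definition is_interp :: "('d, 'c, 'r) interp \<Rightarrow> bool" where
  "is_interp I \<longleftrightarrow> Dom I \<noteq> {} \<and> (\<forall>A. con I A \<subseteq> Dom I) \<and> (\<forall>R. rol I R \<subseteq> Dom I \<times> Dom I)"

function lit_ext :: "('d, 'c, 'r) interp \<Rightarrow> ('c, 'r) lit \<Rightarrow> 'd set" where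
  "lit_ext I (Pos A) = con I A"
| "lit_ext I (Neg A) = Dom I - con I A"
| "lit_ext I (Ex R F) =
     {x \<in> Dom I. \<exists>y \<in> Dom I. (x, y) \<in> rol I R \<and> (\<forall>CL |\<in>| F. \<exists>L |\<in>| CL. y \<in> lit_ext I L)}"
| "lit_ext I (All R F) =
     {x \<in> Dom I. \<forall>y \<in> Dom I. (x, y) \<in> rol I R \<longrightarrow> (\<forall>CL |\<in>| F. \<exists>L |\<in>| CL. y \<in> lit_ext I L)}"
  by pat_completeness auto
termination
  by (relation "measure (\<lambda>(I, L). size L)") (auto simp del: lit.size intro: size_lit_less)

definition cset_ext :: "('d, 'c, 'r) interp \<Rightarrow> ('c, 'r) cset \<Rightarrow> 'd set" where
  "cset_ext I F = {x \<in> Dom I. \<forall>CL |\<in>| F. \<exists>L |\<in>| CL. x \<in> lit_ext I L}"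

lemma lit_ext_quant:
  "lit_ext I (Ex R F) = {x \<in> Dom I. \<exists>y. (x, y) \<in> rol I R \<and> y \<in> cset_ext I F}"
  "lit_ext I (All R F) = {x \<in> Dom I. \<forall>y \<in> Dom I. (x, y) \<in> rol I R \<longrightarrow> y \<in> cset_ext I F}"
  by (auto simp: cset_ext_def)

text \<open>HOL cannot quantify over the type of the domain elements inside a formula, so the domain is
  taken to be a nonempty subset of the natural numbers. The lemma \<open>satisfiable_if_model\<close> below shows
  that this is no restriction: a clause set with a model over any domain is satisfiable
  in this sense.\<close>

definition satisfiable :: "('c, 'r) cset \<Rightarrow> bool" where
  "satisfiable F \<longleftrightarrow> (\<exists>I :: (nat, 'c, 'r) interp. is_interp I \<and> cset_ext I F \<noteq> {})"

definition lit_closed :: "('c, 'r) lit set \<Rightarrow> bool" where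
  "lit_closed \<Sigma> \<longleftrightarrow>
    (\<forall>R G CL L. Ex R G \<in> \<Sigma> \<or> All R G \<in> \<Sigma> \<longrightarrow> CL |\<in>| G \<longrightarrow> L |\<in>| CL \<longrightarrow> L \<in> \<Sigma>)"

lemma lit_closedD:
  "lit_closed \<Sigma> \<Longrightarrow> Ex R G \<in> \<Sigma> \<or> All R G \<in> \<Sigma> \<Longrightarrow> CL |\<in>| G \<Longrightarrow> L |\<in>| CL \<Longrightarrow> L \<in> \<Sigma>"
  unfolding lit_closed_def by blast

lemma lit_closed_finite:
  fixes L :: "('c, 'r) lit"
  shows "\<exists>\<Sigma>. finite \<Sigma> \<and> L \<in> \<Sigma> \<and> lit_closed \<Sigma>"
proof -
  have quant: "\<exists>\<Sigma>. finite \<Sigma> \<and> Ex R F \<in> \<Sigma> \<and> All R F \<in> \<Sigma> \<and> lit_closed \<Sigma>"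
    if IH: "\<And>CL L. CL |\<in>| F \<Longrightarrow> L |\<in>| CL \<Longrightarrow> \<exists>\<Sigma>. finite \<Sigma> \<and> L \<in> \<Sigma> \<and> lit_closed \<Sigma>"
    for R and F :: "('c, 'r) cset"
  proof -
    define \<sigma> where "\<sigma> L = (SOME \<Sigma>. finite \<Sigma> \<and> L \<in> \<Sigma> \<and> lit_closed \<Sigma>)" for L :: "('c, 'r) lit"
    have \<sigma>: "finite (\<sigma> L) \<and> L \<in> \<sigma> L \<and> lit_closed (\<sigma> L)" if "CL |\<in>| F" "L |\<in>| CL" for CL L
      unfolding \<sigma>_def by (rule someI_ex[OF IH[OF that]])
    define T where "T = (\<Union>CL \<in> fset F. \<Union>L \<in> fset CL. \<sigma> L)"
    have fin: "finite T" unfolding T_def using \<sigma> by auto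
    have sub: "L \<in> T" if "CL |\<in>| F" "L |\<in>| CL" for CL L
      unfolding T_def using \<sigma> that by blast
    have T: "L' \<in> T" if QG: "Ex Q G \<in> T \<or> All Q G \<in> T" "CL' |\<in>| G" "L' |\<in>| CL'" for Q G CL' L'
    proof -
      obtain CL L where L: "CL |\<in>| F" "L |\<in>| CL" "Ex Q G \<in> \<sigma> L \<or> All Q G \<in> \<sigma> L"
        using QG(1) unfolding T_def by blast
      then have "L' \<in> \<sigma> L" using \<sigma> lit_closedD QG(2,3) by metis
      then show ?thesis using L unfolding T_def by blast
    qed
    have "lit_closed (insert (Ex R F) (insert (All R F) T))"
      unfolding lit_closed_def
    proof (intro allI impI)
      fix Q G CL' L'
      assume a: "Ex Q G \<in> insert (Ex R F) (insert (All R F) T) \<or> All Q G \<in> insert (Ex R F) (insert (All R F) T)"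
        and "CL' |\<in>| G" "L' |\<in>| CL'"
      moreover have "G = F \<or> Ex Q G \<in> T \<or> All Q G \<in> T" using a by auto
      ultimately have "L' \<in> T" using T sub by metis
      then show "L' \<in> insert (Ex R F) (insert (All R F) T)" by simp
    qed
    then show ?thesis using fin
      by (intro exI[of _ "insert (Ex R F) (insert (All R F) T)"]) simp
  qed
  show ?thesis
  proof (induction L)
    case (Pos A) show ?case by (rule exI[of _ "{Pos A}"]) (simp add: lit_closed_def)
  next
    case (Neg A) show ?case by (rule exI[of _ "{Neg A}"]) (simp add: lit_closed_def)
  next
    case (Ex R F)
    have "\<exists>\<Sigma>. finite \<Sigma> \<and> Ex R F \<in> \<Sigma> \<and> All R F \<in> \<Sigma> \<and> lit_closed \<Sigma>"
      by (rule quant) (rule Ex)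
    then show ?case by metis
  next
    case (All R F)
    have "\<exists>\<Sigma>. finite \<Sigma> \<and> Ex R F \<in> \<Sigma> \<and> All R F \<in> \<Sigma> \<and> lit_closed \<Sigma>"
      by (rule quant) (rule All)
    then show ?case by metis
  qed
qed

lemma satisfiable_if_model:
  fixes I :: "('d, 'c, 'r) interp" and F :: "('c, 'r) cset"
  assumes I: "is_interp I" and "cset_ext I F \<noteq> {}"
  shows "satisfiable F"
proof -
  define R0 :: 'r where "R0 = undefined"
  obtain \<Sigma> where \<Sigma>: "finite \<Sigma>" "Ex R0 F \<in> \<Sigma>" and closed: "lit_closed \<Sigma>"
    using lit_closed_finite[of "Ex R0 F"] by metis
  obtain e :: "('c, 'r) lit set \<Rightarrow> nat" where e: "inj_on e (Pow \<Sigma>)"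
    using finite_imp_inj_to_nat_seg[of "Pow \<Sigma>"] \<Sigma>(1) by blast
  define h where "h d = e {L \<in> \<Sigma>. d \<in> lit_ext I L}" for d
  have h: "d \<in> lit_ext I L \<longleftrightarrow> d' \<in> lit_ext I L" if "h d = h d'" "L \<in> \<Sigma>" for d d' L
  proof -
    have "{L \<in> \<Sigma>. d \<in> lit_ext I L} = {L \<in> \<Sigma>. d' \<in> lit_ext I L}"
      using that(1) unfolding h_def by (intro inj_onD[OF e]) auto
    then show ?thesis using that(2) by blast
  qed
  define J :: "(nat, 'c, 'r) interp" where
    "J = \<lparr>Dom = h ` Dom I, con = (\<lambda>A. h ` con I A), rol = (\<lambda>R. map_prod h h ` rol I R)\<rparr>"
  have J: "is_interp J" using I unfolding is_interp_def J_def by (fastforce simp: image_iff)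
  have Isub: "con I A \<subseteq> Dom I" "rol I R \<subseteq> Dom I \<times> Dom I" for A R
    using I by (auto simp: is_interp_def)
  have truth: "L \<in> \<Sigma> \<Longrightarrow> d \<in> Dom I \<Longrightarrow> h d \<in> lit_ext J L \<longleftrightarrow> d \<in> lit_ext I L" for L d
  proof (induction L arbitrary: d)
    case (Pos A)
    have "d \<in> con I A" if "d' \<in> con I A" "h d = h d'" for d'
      using h[OF that(2) Pos.prems(1)] that(1) by simp
    then show ?case by (auto simp: J_def)
  next
    case (Neg A)
    have "d \<in> con I A" if "d' \<in> con I A" "h d = h d'" for d'
      using h[OF that(2) Neg.prems(1)] that(1) Neg.prems(2) by simp
    then show ?case using Neg.prems(2) by (auto simp: J_def)
  next
    case (Ex R G)
    have G: "h y \<in> cset_ext J G \<longleftrightarrow> y \<in> cset_ext I G" if "y \<in> Dom I" for y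
    proof -
      have "h y \<in> lit_ext J L \<longleftrightarrow> y \<in> lit_ext I L" if "CL |\<in>| G" "L |\<in>| CL" for CL L
        using Ex.IH[OF that lit_closedD[OF closed _ that] \<open>y \<in> Dom I\<close>] Ex.prems by blast
      moreover have "h y \<in> Dom J" using that by (simp add: J_def)
      ultimately show ?thesis using that unfolding cset_ext_def by blast
    qed
    show ?case
    proof
      assume "h d \<in> lit_ext J (Ex R G)"
      then obtain d' y where "h d = h d'" "(d', y) \<in> rol I R" "h y \<in> cset_ext J G"
        unfolding lit_ext_quant by (auto simp: J_def)
      moreover then have "d' \<in> lit_ext I (Ex R G)"
        using G Isub unfolding lit_ext_quant by blast
      ultimately show "d \<in> lit_ext I (Ex R G)" using h[OF _ Ex.prems(1)] by blast
    next
      assume "d \<in> lit_ext I (Ex R G)"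
      then obtain y where y: "(d, y) \<in> rol I R" "y \<in> cset_ext I G"
        unfolding lit_ext_quant by blast
      then have "h y \<in> cset_ext J G" using G Isub by blast
      moreover have "(h d, h y) \<in> rol J R" using y by (force simp: J_def)
      moreover have "h d \<in> Dom J" using Ex.prems by (simp add: J_def)
      ultimately show "h d \<in> lit_ext J (Ex R G)" unfolding lit_ext_quant by blast
    qed
  next
    case (All R G)
    have G: "h y \<in> cset_ext J G \<longleftrightarrow> y \<in> cset_ext I G" if "y \<in> Dom I" for y
    proof -
      have "h y \<in> lit_ext J L \<longleftrightarrow> y \<in> lit_ext I L" if "CL |\<in>| G" "L |\<in>| CL" for CL L
        using All.IH[OF that lit_closedD[OF closed _ that] \<open>y \<in> Dom I\<close>] All.prems by blast
      moreover have "h y \<in> Dom J" using that by (simp add: J_def)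
      ultimately show ?thesis using that unfolding cset_ext_def by blast
    qed
    show ?case
    proof
      assume a: "h d \<in> lit_ext J (All R G)"
      have "y \<in> cset_ext I G" if "(d, y) \<in> rol I R" for y
      proof -
        have "(h d, h y) \<in> rol J R" using that by (force simp: J_def)
        then show ?thesis using a G Isub that J unfolding lit_ext_quant is_interp_def by blast
      qed
      then show "d \<in> lit_ext I (All R G)" using All.prems unfolding lit_ext_quant by blast
    next
      assume a: "d \<in> lit_ext I (All R G)"
      have "z \<in> cset_ext J G" if "(h d, z) \<in> rol J R" for z
      proof -
        obtain d' y where y: "h d = h d'" "z = h y" "(d', y) \<in> rol I R"
          using \<open>(h d, z) \<in> rol J R\<close> by (auto simp: J_def)
        then have "d' \<in> lit_ext I (All R G)" using a h[OF _ All.prems(1)] by blast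
        then show ?thesis using y G Isub unfolding lit_ext_quant by blast
      qed
      moreover have "h d \<in> Dom J" using All.prems by (simp add: J_def)
      ultimately show "h d \<in> lit_ext J (All R G)" unfolding lit_ext_quant by blast
    qed
  qed
  obtain x where x: "x \<in> cset_ext I F" using assms(2) by blast
  have "h x \<in> cset_ext J F"
    using x truth lit_closedD[OF closed disjI1[OF \<Sigma>(2)]] unfolding cset_ext_def by (fastforce simp: J_def)
  then show ?thesis using J unfolding satisfiable_def by blast
qed


section \<open>Complementary literals\<close>

text \<open>Pushing the negation of a clause set \<open>F\<close> inward gives the disjunction over all clauses
  \<open>CL\<close> in \<open>F\<close> of the conjunction over all \<open>L\<close> in \<open>CL\<close> of \<open>g L\<close>, where \<open>g\<close> complements literals.
  Distributing disjunction over conjunction and flattening yields one clause for every way of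
  selecting a literal \<open>f CL\<close> from each clause \<open>CL\<close>, namely the set of all \<open>g (f CL)\<close>.\<close>

definition cnf_neg :: "(('c, 'r) lit \<Rightarrow> ('c, 'r) lit) \<Rightarrow> ('c, 'r) cset \<Rightarrow> ('c, 'r) cset" where
  "cnf_neg g F = Abs_fset ((\<lambda>f. (\<lambda>CL. g (f CL)) |`| F) ` (\<Pi>\<^sub>E CL \<in> fset F. fset CL))"

lemma fset_cnf_neg:
  "fset (cnf_neg g F) = (\<lambda>f. (\<lambda>CL. g (f CL)) |`| F) ` (\<Pi>\<^sub>E CL \<in> fset F. fset CL)"
  unfolding cnf_neg_def by (intro Abs_fset_inverse) (auto intro!: finite_PiE)

lemma cnf_neg_cong [fundef_cong]:
  assumes "F = G" "\<And>CL L. CL |\<in>| G \<Longrightarrow> L |\<in>| CL \<Longrightarrow> g L = h L"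
  shows "cnf_neg g F = cnf_neg h G"
proof -
  have "(\<lambda>CL. g (f CL)) |`| G = (\<lambda>CL. h (f CL)) |`| G" if "f \<in> (\<Pi>\<^sub>E CL \<in> fset G. fset CL)" for f
    using that assms(2) by (intro fimage_cong) (auto simp: PiE_mem)
  then show ?thesis unfolding cnf_neg_def assms(1) by (metis (no_types, lifting) image_cong)
qed

function compl_lit :: "('c, 'r) lit \<Rightarrow> ('c, 'r) lit" where
  "compl_lit (Pos A) = Neg A"
| "compl_lit (Neg A) = Pos A"
| "compl_lit (Ex R F) = All R (cnf_neg compl_lit F)"
| "compl_lit (All R F) = Ex R (cnf_neg compl_lit F)"
  by pat_completeness auto
termination
  by (relation "measure size") (auto simp del: lit.size intro: size_lit_less)

lemma cnf_neg_ext: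
  assumes "\<And>CL L. CL |\<in>| F \<Longrightarrow> L |\<in>| CL \<Longrightarrow> lit_ext I (g L) = Dom I - lit_ext I L"
  shows "cset_ext I (cnf_neg g F) = Dom I - cset_ext I F"
proof (intro set_eqI iffI)
  fix x assume x: "x \<in> cset_ext I (cnf_neg g F)"
  show "x \<in> Dom I - cset_ext I F"
  proof (rule ccontr)
    assume "\<not> ?thesis"
    then have "\<forall>CL |\<in>| F. \<exists>L |\<in>| CL. x \<in> lit_ext I L" using x by (auto simp: cset_ext_def)
    then obtain f where f: "\<And>CL. CL |\<in>| F \<Longrightarrow> f CL |\<in>| CL \<and> x \<in> lit_ext I (f CL)" by metis
    then have "restrict f (fset F) \<in> (\<Pi>\<^sub>E CL \<in> fset F. fset CL)" by auto
    then have "(\<lambda>CL. g (restrict f (fset F) CL)) |`| F |\<in>| cnf_neg g F"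
      unfolding fset_cnf_neg by blast
    then obtain CL where "CL |\<in>| F" "x \<in> lit_ext I (g (restrict f (fset F) CL))"
      using x by (fastforce simp: cset_ext_def)
    then show False using f assms by auto
  qed
next
  fix x assume x: "x \<in> Dom I - cset_ext I F"
  then obtain CL where CL: "CL |\<in>| F" "\<And>L. L |\<in>| CL \<Longrightarrow> x \<notin> lit_ext I L"
    by (auto simp: cset_ext_def)
  have "\<exists>L |\<in>| D. x \<in> lit_ext I L" if "D |\<in>| cnf_neg g F" for D
  proof -
    obtain f where f: "f \<in> (\<Pi>\<^sub>E CL \<in> fset F. fset CL)" "D = (\<lambda>CL. g (f CL)) |`| F"
      using \<open>D |\<in>| cnf_neg g F\<close> unfolding fset_cnf_neg by blast
    then have "f CL |\<in>| CL" "g (f CL) |\<in>| D" using CL(1) by (auto simp: PiE_mem)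
    then show ?thesis using assms[OF CL(1)] CL(2) x by blast
  qed
  then show "x \<in> cset_ext I (cnf_neg g F)" using x by (auto simp: cset_ext_def)
qed

lemma compl_lit_ext:
  assumes "is_interp I"
  shows "lit_ext I (compl_lit L) = Dom I - lit_ext I L"
proof (induction L)
  case (Pos A) show ?case by simp
next
  case (Neg A) then show ?case using assms by (auto simp: is_interp_def)
next
  case (Ex R F)
  then have "cset_ext I (cnf_neg compl_lit F) = Dom I - cset_ext I F" by (intro cnf_neg_ext) blast
  then show ?case using assms unfolding compl_lit.simps lit_ext_quant is_interp_def by blast
next
  case (All R F)
  then have "cset_ext I (cnf_neg compl_lit F) = Dom I - cset_ext I F" by (intro cnf_neg_ext) blast
  then show ?case using assms unfolding compl_lit.simps lit_ext_quant is_interp_def by blast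
qed


section \<open>Inference rules\<close>

definition unit_clause :: "('c, 'r) clause \<Rightarrow> bool" where
  "unit_clause CL \<longleftrightarrow> (\<exists>L. CL = {|L|})"

text \<open>A clause containing both \<open>L\<close> and its complement becomes the unit clause of \<open>L\<close>.\<close>

definition choose_lit :: "('c, 'r) lit \<Rightarrow> ('c, 'r) cset \<Rightarrow> ('c, 'r) cset" where
  "choose_lit L F = (\<lambda>CL. if L |\<in>| CL then {|L|} else CL |-| {|compl_lit L|}) |`| F"

fun add_to_ex :: "'r \<Rightarrow> ('c, 'r) cset \<Rightarrow> ('c, 'r) lit \<Rightarrow> ('c, 'r) lit" where
  "add_to_ex R F\<^sub>1 (Ex Q F\<^sub>2) = (if Q = R then Ex R (F\<^sub>1 |\<union>| F\<^sub>2) else Ex Q F\<^sub>2)"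
| "add_to_ex R F\<^sub>1 L = L"

definition propagate_all :: "'r \<Rightarrow> ('c, 'r) cset \<Rightarrow> ('c, 'r) cset \<Rightarrow> ('c, 'r) cset" where
  "propagate_all R F\<^sub>1 F = (\<lambda>CL. add_to_ex R F\<^sub>1 |`| CL) |`| ffilter (\<lambda>CL. All R F\<^sub>1 |\<notin>| CL) F"

text \<open>A family of clause sets is an indexed family, here a list, together with its parent relation:
  \<open>(i, R, j)\<close> says that the member at index \<open>i\<close> is the parent of the one at index \<open>j\<close> with respect
  to \<open>R\<close>. Applying a rule to a member keeps its index.\<close>

type_synonym ('c, 'r) family = "('c, 'r) cset list \<times> (nat \<times> 'r \<times> nat) set"

text \<open>The rule \<open>A1\<close> only counts as applicable if it changes the clause set; otherwise it would apply
  to every clause set that has a nonempty clause (choose the literal of a unit clause again and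
  again), and no such clause set could occur in a complete family. The other two rules always change
  the clause set they are applied to.\<close>

inductive step :: "('c, 'r) family \<Rightarrow> ('c, 'r) family \<Rightarrow> bool" where
  A1: "i < length S \<Longrightarrow> CL |\<in>| S ! i \<Longrightarrow> L |\<in>| CL \<Longrightarrow> choose_lit L (S ! i) \<noteq> S ! i \<Longrightarrow>
    step (S, P) (S[i := choose_lit L (S ! i)], P)"
| A2: "i < length S \<Longrightarrow> (\<forall>CL |\<in>| S ! i. unit_clause CL) \<Longrightarrow> CL |\<in>| S ! i \<Longrightarrow> All R F\<^sub>1 |\<in>| CL \<Longrightarrow>
    step (S, P) (S[i := propagate_all R F\<^sub>1 (S ! i)], P)"
| A3: "i < length S \<Longrightarrow>
    (\<forall>CL |\<in>| S ! i. (\<exists>A. CL = {|Pos A|}) \<or> (\<exists>A. CL = {|Neg A|}) \<or> (\<exists>Q G. CL = {|Ex Q G|})) \<Longrightarrow>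
    {|Ex R F\<^sub>1|} |\<in>| S ! i \<Longrightarrow>
    step (S, P) (S[i := S ! i |-| {|{|Ex R F\<^sub>1|}|}] @ [F\<^sub>1], insert (i, R, length S) P)"

definition derivable :: "('c, 'r) cset \<Rightarrow> ('c, 'r) family \<Rightarrow> bool" where
  "derivable F \<S> \<longleftrightarrow> step\<^sup>*\<^sup>* ([F], {}) \<S>"

definition complete_family :: "('c, 'r) family \<Rightarrow> bool" where
  "complete_family \<S> \<longleftrightarrow> (\<nexists>\<S>'. step \<S> \<S>')"

definition clash_free :: "('c, 'r) family \<Rightarrow> bool" where
  "clash_free \<S> \<longleftrightarrow>
    (\<forall>F \<in> set (fst \<S>). {||} |\<notin>| F \<and> \<not> (\<exists>L. {|L|} |\<in>| F \<and> {|compl_lit L|} |\<in>| F))"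

end

theory Submission
  imports Defs
begin

text \<open>The indices of the final family, with the final parent relation as roles and the remaining
  positive unit clauses as concept extensions, form a model in which, at every stage of the
  derivation, each index satisfies its current clause set. This is shown backwards along the
  derivation. The delicate rule is \<open>A2\<close>, which drops a universal literal: since \<open>A3\<close> is blocked
  while universal literals are present, every successor is created afterwards, from an existential
  literal into which the dropped clause set has already been merged. The invariant therefore also
  says that each successor still to be created satisfies the clause set of some existential literal
  that is currently present.\<close>

section \<open>Inference rules on a single clause set\<close>

lemma cset_ext_subset_if_subsumed:
  assumes "\<And>CL. CL |\<in>| F \<Longrightarrow> \<exists>CL' |\<in>| G. CL' |\<subseteq>| CL"
  shows "cset_ext I G \<subseteq> cset_ext I F"
proof
  fix x assume x: "x \<in> cset_ext I G"
  have "\<exists>L |\<in>| CL. x \<in> lit_ext I L" if "CL |\<in>| F" for CL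
  proof -
    obtain CL' where "CL' |\<in>| G" "CL' |\<subseteq>| CL" using assms \<open>CL |\<in>| F\<close> by blast
    then show ?thesis using x unfolding cset_ext_def by blast
  qed
  then show "x \<in> cset_ext I F" using x by (simp add: cset_ext_def)
qed

lemma cset_ext_antimono: "F |\<subseteq>| G \<Longrightarrow> cset_ext I G \<subseteq> cset_ext I F"
  by (rule cset_ext_subset_if_subsumed) blast

lemma cset_ext_choose_lit_subset: "cset_ext I (choose_lit L F) \<subseteq> cset_ext I F"
proof (rule cset_ext_subset_if_subsumed)
  fix CL assume "CL |\<in>| F"
  then have "(if L |\<in>| CL then {|L|} else CL |-| {|compl_lit L|}) |\<in>| choose_lit L F"
    unfolding choose_lit_def by (rule fimageI)
  then show "\<exists>CL' |\<in>| choose_lit L F. CL' |\<subseteq>| CL"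
    by (rule rev_bexI) auto
qed

lemma lit_ext_add_to_ex_subset: "lit_ext I (add_to_ex R G L) \<subseteq> lit_ext I L"
proof (cases L)
  case (Ex Q H)
  have "cset_ext I (G |\<union>| H) \<subseteq> cset_ext I H" by (rule cset_ext_antimono) simp
  then show ?thesis unfolding Ex by (auto simp: lit_ext_quant simp del: lit_ext.simps(3,4))
qed simp_all

lemma cset_ext_propagate_all_Int_subset:
  "cset_ext I (propagate_all R G F) \<inter> lit_ext I (All R G) \<subseteq> cset_ext I F"
proof
  fix x assume x: "x \<in> cset_ext I (propagate_all R G F) \<inter> lit_ext I (All R G)"
  have "\<exists>L |\<in>| CL. x \<in> lit_ext I L" if "CL |\<in>| F" "All R G |\<notin>| CL" for CL
  proof -
    have "add_to_ex R G |`| CL |\<in>| propagate_all R G F"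
      using that by (auto simp: propagate_all_def)
    then obtain L where "L |\<in>| CL" "x \<in> lit_ext I (add_to_ex R G L)"
      using x by (fastforce simp: cset_ext_def)
    then show ?thesis using lit_ext_add_to_ex_subset[of I R G L] by blast
  qed
  then show "x \<in> cset_ext I F" using x unfolding cset_ext_def by blast
qed

lemma cset_ext_fminus_Int_subset:
  "cset_ext I (F |-| {|{|L|}|}) \<inter> lit_ext I L \<subseteq> cset_ext I F"
proof
  fix x assume x: "x \<in> cset_ext I (F |-| {|{|L|}|}) \<inter> lit_ext I L"
  have "\<exists>M |\<in>| CL. x \<in> lit_ext I M" if "CL |\<in>| F" for CL
    using x that by (cases "CL = {|L|}") (auto simp: cset_ext_def)
  then show "x \<in> cset_ext I F" using x by (simp add: cset_ext_def)
qed

lemma ffUnion_choose_lit_subset: "ffUnion (choose_lit L F) |\<subseteq>| ffUnion F"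
  by (auto simp: choose_lit_def ffUnion.rep_eq split: if_splits)

lemma Ex_in_propagate_allD:
  assumes "Ex Q H |\<in>| ffUnion (propagate_all R G F)"
  obtains H' where "Ex Q H' |\<in>| ffUnion F" "H' |\<subseteq>| H" "Q = R \<Longrightarrow> G |\<subseteq>| H"
proof -
  obtain L where L: "L |\<in>| ffUnion F" "Ex Q H = add_to_ex R G L"
    using assms by (auto simp: propagate_all_def ffUnion.rep_eq)
  then obtain H' where "L = Ex Q H'" by (cases L) (auto split: if_splits)
  then show thesis using L by (intro that[of H']) (auto split: if_splits)
qed


section \<open>Elements with pending successors\<close>

text \<open>An \<open>R\<close>-successor \<open>y\<close> of \<open>x\<close> in \<open>I\<close> is pending if the current parent relation \<open>P\<close> does
  not contain \<open>(x, R, y)\<close> yet.\<close>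

definition realized_at ::
    "('d, 'c, 'r) interp \<Rightarrow> ('d \<times> 'r \<times> 'd) set \<Rightarrow> 'd \<Rightarrow> ('c, 'r) cset \<Rightarrow> bool" where
  "realized_at I P x F \<longleftrightarrow> x \<in> cset_ext I F \<and>
     (\<forall>R y. (x, y) \<in> rol I R \<longrightarrow> (x, R, y) \<notin> P \<longrightarrow>
        (\<exists>H. Ex R H |\<in>| ffUnion F \<and> y \<in> cset_ext I H))"

lemma realized_at_imp_ext: "realized_at I P x F \<Longrightarrow> x \<in> cset_ext I F"
  by (simp add: realized_at_def)

lemma realized_at_pendingE:
  assumes "realized_at I P x F" "(x, y) \<in> rol I R" "(x, R, y) \<notin> P"
  obtains H where "Ex R H |\<in>| ffUnion F" "y \<in> cset_ext I H"
  using assms unfolding realized_at_def by blast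

lemma realized_at_choose_lit:
  "realized_at I P x (choose_lit L F) \<Longrightarrow> realized_at I P x F"
  using cset_ext_choose_lit_subset[of I L F] ffUnion_choose_lit_subset[of L F]
  unfolding realized_at_def by blast

lemma realized_at_propagate_all:
  assumes realized: "realized_at I P x (propagate_all R G F)"
    and all_pending: "\<And>y. (x, R, y) \<notin> P"
  shows "realized_at I P x F"
proof -
  have pending: "\<exists>H. Ex Q H |\<in>| ffUnion F \<and> y \<in> cset_ext I H \<and> (Q = R \<longrightarrow> y \<in> cset_ext I G)"
    if "(x, y) \<in> rol I Q" "(x, Q, y) \<notin> P" for Q y
  proof -
    obtain H where "Ex Q H |\<in>| ffUnion (propagate_all R G F)" and y: "y \<in> cset_ext I H"
      using realized_at_pendingE[OF realized \<open>(x, y) \<in> rol I Q\<close> \<open>(x, Q, y) \<notin> P\<close>] .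
    then obtain H' where "Ex Q H' |\<in>| ffUnion F" "H' |\<subseteq>| H" "Q = R \<Longrightarrow> G |\<subseteq>| H"
      using Ex_in_propagate_allD by metis
    then show ?thesis using y cset_ext_antimono[of _ H I] by blast
  qed
  have ext: "x \<in> cset_ext I (propagate_all R G F)" using realized by (rule realized_at_imp_ext)
  then have "x \<in> lit_ext I (All R G)"
    using pending all_pending unfolding lit_ext_quant cset_ext_def by blast
  then have "x \<in> cset_ext I F" using ext cset_ext_propagate_all_Int_subset[of I R G F] by blast
  then show ?thesis using pending unfolding realized_at_def by blast
qed

lemma realized_at_fminus_Ex:
  assumes realized: "realized_at I (insert (x, R, y) P) x (F |-| {|{|Ex R G|}|})"
    and "{|Ex R G|} |\<in>| F" "(x, y) \<in> rol I R" "y \<in> cset_ext I G"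
  shows "realized_at I P x F"
proof -
  have ext: "x \<in> cset_ext I (F |-| {|{|Ex R G|}|})" using realized by (rule realized_at_imp_ext)
  then have "x \<in> lit_ext I (Ex R G)"
    using assms(3,4) unfolding lit_ext_quant cset_ext_def by blast
  then have "x \<in> cset_ext I F" using ext cset_ext_fminus_Int_subset[of I F "Ex R G"] by blast
  moreover have "\<exists>H. Ex Q H |\<in>| ffUnion F \<and> z \<in> cset_ext I H"
    if "(x, z) \<in> rol I Q" "(x, Q, z) \<notin> P" for Q z
  proof (cases "(Q, z) = (R, y)")
    case True
    then show ?thesis using assms(2,4) by (force simp: ffUnion.rep_eq)
  next
    case False
    then have "(x, Q, z) \<notin> insert (x, R, y) P" using that(2) by blast
    then obtain H where "Ex Q H |\<in>| ffUnion (F |-| {|{|Ex R G|}|})" "z \<in> cset_ext I H"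
      using realized_at_pendingE[OF realized \<open>(x, z) \<in> rol I Q\<close>] by blast
    then show ?thesis by (auto simp: ffUnion.rep_eq)
  qed
  ultimately show ?thesis unfolding realized_at_def by blast
qed


section \<open>Well-formed families\<close>

definition universal_free :: "('c, 'r) cset \<Rightarrow> bool" where
  "universal_free F \<longleftrightarrow> (\<forall>R G. All R G |\<notin>| ffUnion F)"

lemma All_in_clause_imp_not_universal_free:
  "CL |\<in>| F \<Longrightarrow> All R G |\<in>| CL \<Longrightarrow> \<not> universal_free F"
  by (auto simp: universal_free_def ffUnion.rep_eq)

lemma universal_free_mono:
  "universal_free F \<Longrightarrow> ffUnion G |\<subseteq>| ffUnion F \<Longrightarrow> universal_free G"
  unfolding universal_free_def by blast

definition wf_family :: "('c, 'r) family \<Rightarrow> bool" where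
  "wf_family \<S> \<longleftrightarrow> (\<forall>(i, R, j) \<in> snd \<S>.
     i < length (fst \<S>) \<and> j < length (fst \<S>) \<and> universal_free (fst \<S> ! i))"

lemma wf_familyD:
  assumes "wf_family (S, P)" "(i, R, j) \<in> P"
  shows "i < length S" "j < length S" "universal_free (S ! i)"
  using assms by (auto simp: wf_family_def)

lemma wf_family_update:
  assumes "wf_family (S, P)"
    and "\<And>R j. (n, R, j) \<in> P \<Longrightarrow> universal_free (S ! n) \<Longrightarrow> universal_free F"
  shows "wf_family (S[n := F], P)"
proof -
  have "universal_free (S[n := F] ! i)" if "(i, R, j) \<in> P" for i R j
    using wf_familyD[OF assms(1) that] assms(2) that by (cases "i = n") auto
  then show ?thesis using wf_familyD(1,2)[OF assms(1)] by (auto simp: wf_family_def)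
qed

lemma wf_family_append:
  assumes "wf_family (S, P)" "i < length S" "universal_free (S ! i)"
  shows "wf_family (S @ [F], insert (i, R, length S) P)"
  using assms by (fastforce simp: wf_family_def nth_append)

lemma wf_family_step:
  assumes "step \<S> \<S>'" "wf_family \<S>"
  shows "wf_family \<S>'"
  using assms
proof (induction rule: step.induct)
  case (A1 i S CL L P)
  show ?case
    using A1.prems universal_free_mono[OF _ ffUnion_choose_lit_subset]
    by (rule wf_family_update)
next
  case (A2 i S CL R G P)
  have "\<not> universal_free (S ! i)"
    using A2.hyps(3,4) by (rule All_in_clause_imp_not_universal_free)
  then show ?case using A2.prems by (intro wf_family_update) auto
next
  case (A3 i S R G P)
  let ?F = "S ! i |-| {|{|Ex R G|}|}"
  have "universal_free ?F"
    using A3.hyps(2) by (fastforce simp: universal_free_def ffUnion.rep_eq)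
  moreover from this have "wf_family (S[i := ?F], P)" using A3.prems by (intro wf_family_update)
  ultimately show ?case using wf_family_append[of "S[i := ?F]" P i G R] A3.hyps(1) by simp
qed

lemma wf_family_derivable:
  assumes "derivable F \<S>"
  shows "wf_family \<S>"
  using assms unfolding derivable_def
proof (induction rule: rtranclp_induct)
  case base
  show ?case by (simp add: wf_family_def)
next
  case (step \<S> \<S>')
  then show ?case using wf_family_step by blast
qed


section \<open>Realizations of families\<close>

definition realizes_family :: "(nat, 'c, 'r) interp \<Rightarrow> ('c, 'r) family \<Rightarrow> bool" where
  "realizes_family I \<S> \<longleftrightarrow> (\<forall>(i, R, j) \<in> snd \<S>. (i, j) \<in> rol I R) \<and>
     (\<forall>i < length (fst \<S>). realized_at I (snd \<S>) i (fst \<S> ! i))"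

lemma realizes_family_updateD:
  assumes "realizes_family I (S[n := F], P)" "n < length S"
    and "realized_at I P n F \<Longrightarrow> realized_at I P n (S ! n)"
  shows "realizes_family I (S, P)"
proof -
  have realized: "realized_at I P i (S[n := F] ! i)" if "i < length S" for i
    using assms(1) that by (simp add: realizes_family_def)
  have "realized_at I P i (S ! i)" if "i < length S" for i
    using realized[OF that] that assms(3) by (cases "i = n") simp_all
  then show ?thesis using assms(1) by (simp add: realizes_family_def)
qed

lemma realizes_family_new_childD:
  assumes "realizes_family I (S[n := S ! n |-| {|{|Ex R G|}|}] @ [G], insert (n, R, length S) P)"
    and n: "n < length S" and ex: "{|Ex R G|} |\<in>| S ! n"
  shows "realizes_family I (S, P)"
proof -
  let ?P = "insert (n, R, length S) P"
  have edges: "\<forall>(i, Q, j) \<in> ?P. (i, j) \<in> rol I Q"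
    using assms(1) by (simp add: realizes_family_def)
  have realized: "realized_at I ?P i ((S[n := S ! n |-| {|{|Ex R G|}|}] @ [G]) ! i)"
    if "i < Suc (length S)" for i
    using assms(1) that by (simp add: realizes_family_def)
  have "realized_at I P i (S ! i)" if i: "i < length S" for i
  proof (cases "i = n")
    case True
    have "realized_at I ?P n (S ! n |-| {|{|Ex R G|}|})"
      using realized[of n] n by (simp add: nth_append)
    moreover have "length S \<in> cset_ext I G"
      using realized[of "length S"] realized_at_imp_ext by (fastforce simp: nth_append)
    ultimately show ?thesis using realized_at_fminus_Ex ex edges True by fast
  next
    case False
    then show ?thesis using realized[of i] i by (simp add: nth_append realized_at_def)
  qed
  then show ?thesis using edges by (simp add: realizes_family_def)
qed

lemma realizes_family_step:
  assumes "step \<S> \<S>'" "wf_family \<S>" "realizes_family I \<S>'"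
  shows "realizes_family I \<S>"
  using assms
proof (induction rule: step.induct)
  case (A1 i S CL L P)
  show ?case
    using A1.prems(2) A1.hyps(1) realized_at_choose_lit by (rule realizes_family_updateD)
next
  case (A2 i S CL R G P)
  have "\<not> universal_free (S ! i)"
    using A2.hyps(3,4) by (rule All_in_clause_imp_not_universal_free)
  then have "(i, Q, j) \<notin> P" for Q j using wf_familyD(3)[OF A2.prems(1)] by blast
  then show ?case
    using realizes_family_updateD[OF A2.prems(2) A2.hyps(1)] realized_at_propagate_all by metis
next
  case (A3 i S R G P)
  show ?case using A3.prems(2) A3.hyps(1,3) by (rule realizes_family_new_childD)
qed

lemma realizes_family_steps:
  assumes "step\<^sup>*\<^sup>* \<S> \<T>" "wf_family \<S>" "realizes_family I \<T>"
  shows "realizes_family I \<S>"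
  using assms
proof (induction rule: converse_rtranclp_induct)
  case base
  then show ?case by simp
next
  case (step \<S> \<S>')
  then show ?case using wf_family_step realizes_family_step by blast
qed


section \<open>The canonical interpretation of a complete and clash-free family\<close>

lemma choose_lit_fixed_imp_unit:
  assumes "choose_lit L F = F" "CL |\<in>| F" "L |\<in>| CL"
  shows "CL = {|L|}"
proof -
  have "CL |\<in>| choose_lit L F" using assms by simp
  then show ?thesis using assms(3) by (auto simp: choose_lit_def split: if_splits)
qed

lemma complete_clash_free_clause_cases:
  assumes complete: "complete_family (S, P)" and clash_free: "clash_free (S, P)"
    and i: "i < length S" and CL: "CL |\<in>| S ! i"
  obtains A where "CL = {|Pos A|}" | A where "CL = {|Neg A|}"
proof -
  have no_step: "\<not> step (S, P) \<S>'" for \<S>'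
    using complete unfolding complete_family_def by blast
  have unit: "\<exists>L. D = {|L|}" if D: "D |\<in>| S ! i" for D
  proof -
    have "D \<noteq> {||}" using clash_free i D by (auto simp: clash_free_def)
    then obtain L where L: "L |\<in>| D" by (metis ex_fin_conv)
    then have "choose_lit L (S ! i) = S ! i" using step.A1[OF i D] no_step by blast
    then show ?thesis using choose_lit_fixed_imp_unit D L by blast
  qed
  have no_all: "{|All R G|} |\<notin>| S ! i" for R G
    using step.A2[OF i, of "{|All R G|}" R G P] unit no_step by (auto simp: unit_clause_def)
  have "(\<exists>A. D = {|Pos A|}) \<or> (\<exists>A. D = {|Neg A|}) \<or> (\<exists>Q G. D = {|Ex Q G|})"
    if "D |\<in>| S ! i" for D
    using unit[OF that] no_all that by (metis lit.exhaust)
  moreover from this have "{|Ex R G|} |\<notin>| S ! i" for R G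
    using step.A3[OF i, of R G P] no_step by blast
  ultimately show thesis using that CL by blast
qed

definition canonical_interp :: "('c, 'r) family \<Rightarrow> (nat, 'c, 'r) interp" where
  "canonical_interp \<S> = \<lparr>Dom = {..<length (fst \<S>)},
     con = (\<lambda>A. {i. i < length (fst \<S>) \<and> {|Pos A|} |\<in>| fst \<S> ! i}),
     rol = (\<lambda>R. {(i, j). (i, R, j) \<in> snd \<S>})\<rparr>"

lemma canonical_interp_simps [simp]:
  "Dom (canonical_interp (S, P)) = {..<length S}"
  "i \<in> con (canonical_interp (S, P)) A \<longleftrightarrow> i < length S \<and> {|Pos A|} |\<in>| S ! i"
  "(i, j) \<in> rol (canonical_interp (S, P)) R \<longleftrightarrow> (i, R, j) \<in> P"
  by (auto simp: canonical_interp_def)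

lemma is_interp_canonical_interp:
  assumes "wf_family (S, P)" "S \<noteq> []"
  shows "is_interp (canonical_interp (S, P))"
  using assms wf_familyD(1,2)[OF assms(1)] by (auto simp: is_interp_def lessThan_empty_iff)

lemma realizes_family_canonical_interp:
  assumes "complete_family (S, P)" and clash_free: "clash_free (S, P)"
  shows "realizes_family (canonical_interp (S, P)) (S, P)"
proof -
  let ?I = "canonical_interp (S, P)"
  have "\<exists>L |\<in>| CL. i \<in> lit_ext ?I L" if i: "i < length S" and CL: "CL |\<in>| S ! i" for i CL
    using assms i CL
  proof (cases rule: complete_clash_free_clause_cases)
    case (1 A)
    then show ?thesis using i CL by simp
  next
    case (2 A)
    then have "{|Pos A|} |\<notin>| S ! i"
      using clash_free i CL unfolding clash_free_def by (metis compl_lit.simps(1) fst_conv nth_mem)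
    then show ?thesis using i 2 by simp
  qed
  then show ?thesis by (auto simp: realizes_family_def realized_at_def cset_ext_def)
qed

theorem mainTheorem6:
  fixes F :: "('c, 'r) cset" and \<S> :: "('c, 'r) family"
  assumes "derivable F \<S>"
    and "complete_family \<S>"
    and "clash_free \<S>"
  shows "satisfiable F"
proof -
  let ?I = "canonical_interp \<S>"
  have "realizes_family ?I \<S>"
    using assms(2,3) realizes_family_canonical_interp by (cases \<S>) blast
  moreover have "wf_family ([F], {})" by (simp add: wf_family_def)
  ultimately have "realizes_family ?I ([F], {})"
    using assms(1) realizes_family_steps unfolding derivable_def by blast
  then have root: "0 \<in> cset_ext ?I F"
    using realized_at_imp_ext by (fastforce simp: realizes_family_def)
  then have "fst \<S> \<noteq> []" by (auto simp: cset_ext_def canonical_interp_def)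
  then have "is_interp ?I"
    using wf_family_derivable[OF assms(1)] is_interp_canonical_interp by (cases \<S>) auto
  then show ?thesis using root unfolding satisfiable_def by blast
qed

end
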